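(* For nonzero real $g\in L^2(0,1)$ define $$\theta=\frac{\langle g,K_*g\rangle}{\|g\|_2^2},\qquad \sigma^2=\frac{\|K_*g-\theta g\|_2^2}{\|g\|_2^2}.$$ If $\theta>a_{\mathrm S}$, then $$\theta\le\lambda_*\le\theta+\frac{\sigma^2}{\theta-a_{\mathrm S}}.$$ Moreover, for any real shift $\tau$, $\displaystyle \sigma^2\le\frac{\|K_*g-\tau g\|_2^2}{\|g\|_2^2}$.
   Context: $K_*$ is the bounded, compact, positive self-adjoint operator on $L^2(0,1)$ given by $K_*f(x)=\int_0^1|x-y|^{-1/2}f(y)\,dy$, and $\lambda_*=\lambda_{\max}(K_* )$ is its leading eigenvalue. The constant $a_{\mathrm S}$ is $a_{\mathrm S}=\frac{9+\sqrt3}{8}$. Inner product and norm are those of $L^2(0,1)$. *)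

theory Defs
  imports "HOL-Analysis.Analysis"
begin

text \<open>
  The real Hilbert space \<open>L\<^sup>2(0,1)\<close> is represented by its representatives: square-integrable,
  Lebesgue measurable functions, whose values outside \<open>(0,1)\<close> play no role. Equality of
  elements is equality almost everywhere on \<open>(0,1)\<close>.
\<close>

abbreviation leb01 :: "real measure" where
  "leb01 \<equiv> lebesgue_on {0<..<1}"

definition L2_01 :: "(real \<Rightarrow> real) set" where
  "L2_01 = {f \<in> borel_measurable leb01. integrable leb01 (\<lambda>x. (f x)\<^sup>2)}"

definition L2_eq :: "(real \<Rightarrow> real) \<Rightarrow> (real \<Rightarrow> real) \<Rightarrow> bool" where
  "L2_eq f g \<longleftrightarrow> (AE x in leb01. f x = g x)"

definition L2_inner :: "(real \<Rightarrow> real) \<Rightarrow> (real \<Rightarrow> real) \<Rightarrow> real" where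
  "L2_inner f g = (LINT x|leb01. f x * g x)"

definition L2_nrm :: "(real \<Rightarrow> real) \<Rightarrow> real" where
  "L2_nrm f = sqrt (L2_inner f f)"

text \<open>
  For \<open>f \<in> L\<^sup>2(0,1)\<close> the integral below converges absolutely for almost every \<open>x\<close>, but not
  necessarily for every \<open>x\<close>; on the exceptional null set the Bochner integral takes the default
  value 0. Since \<open>0 powr a = 0\<close>, the integrand vanishes at the single point \<open>y = x\<close>.
\<close>

definition K_star :: "(real \<Rightarrow> real) \<Rightarrow> real \<Rightarrow> real" where
  "K_star f x = (LINT y|leb01. \<bar>x - y\<bar> powr (-1/2) * f y)"

definition L2_eigenvalue :: "((real \<Rightarrow> real) \<Rightarrow> real \<Rightarrow> real) \<Rightarrow> real \<Rightarrow> bool" where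
  "L2_eigenvalue T l \<longleftrightarrow>
    (\<exists>f\<in>L2_01. \<not> L2_eq f (\<lambda>x. 0) \<and> L2_eq (T f) (\<lambda>x. l * f x))"

definition lambda_max :: "((real \<Rightarrow> real) \<Rightarrow> real \<Rightarrow> real) \<Rightarrow> real" where
  "lambda_max T = (GREATEST l. L2_eigenvalue T l)"

definition lambda_star :: real where
  "lambda_star = lambda_max K_star"

definition a_S :: real where
  "a_S = (9 + sqrt 3) / 8"

definition theta :: "(real \<Rightarrow> real) \<Rightarrow> real" where
  "theta g = L2_inner g (K_star g) / (L2_nrm g)\<^sup>2"

definition sigma2 :: "(real \<Rightarrow> real) \<Rightarrow> real" where
  "sigma2 g = (L2_nrm (\<lambda>x. K_star g x - theta g * g x))\<^sup>2 / (L2_nrm g)\<^sup>2"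

end

theory Submission
  imports Defs
begin

text \<open>
  Let \<open>K\<close> be the operator with kernel \<open>\<bar>x - y\<bar> powr (-1/2)\<close>, \<open>\<lambda>\<close> its greatest eigenvalue and \<open>a = a_S\<close>. The upper
  bound is Temple's inequality: if the rest of the spectrum of \<open>K\<close> lies below \<open>a\<close>, then
  \<open>(\<lambda> - K) (a - K) \<ge> 0\<close>, and evaluating this form at \<open>g\<close> gives
  \<open>\<sigma>\<^sup>2 + (\<theta> - \<lambda>) (\<theta> - a) \<ge> 0\<close>. The lower bound is the Rayleigh principle, and the statement on shifts
  holds because \<open>\<parallel>K g - \<tau> g\<parallel>\<^sup>2\<close> is quadratic in \<open>\<tau>\<close> with its minimum at \<open>\<theta>\<close>.

  The spectral gap comes from writing \<open>K = B + 2 1\<otimes>1\<close>, where \<open>B\<close> has the kernel \<open>\<bar>x - y\<bar> powr (-1/2) - 2\<close>.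
  The rows of \<open>B\<close> have absolute integral at most \<open>(9 + sqrt 3) / 8 = a\<close> (\<open>shifted_row_bound\<close>), so by the Schur
  test \<open>B \<le> a\<close> (\<open>inner_op_le\<close>). As \<open>K\<close> and \<open>B\<close> have the same quadratic form on functions of mean zero, a
  space of codimension one, \<open>K\<close> can exceed \<open>a\<close> in at most one direction.

  The same decomposition yields the leading eigenfunction explicitly. Since \<open>B\<close> is also bounded by \<open>a\<close> on bounded functions, the resolvent
  \<open>(\<mu> - B)\<^sup>-\<^sup>1 1\<close> is for \<open>\<mu> > a\<close> a uniformly convergent Neumann series of bounded functions, and it is an
  eigenfunction of \<open>K\<close> for the eigenvalue \<open>\<mu>\<close> when its mean is \<open>1/2\<close>. The intermediate value theorem finds such
  a \<open>\<mu>\<close> in \<open>[2, 2 + a]\<close>, where \<open>2 > a\<close> (\<open>perturbed_eigenfunction\<close>). The inequalities that make this \<open>\<mu>\<close>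
  the greatest eigenvalue and establish the gap are in \<open>leading_eigenvalue\<close>, stated for any kernel
  satisfying the Schur bound and any rank-one perturbation by a large enough constant.
\<close>

section \<open>Square-integrable functions\<close>

definition square_integrable :: "'a measure \<Rightarrow> ('a \<Rightarrow> real) \<Rightarrow> bool" where
  "square_integrable M f \<longleftrightarrow> f \<in> borel_measurable M \<and> integrable M (\<lambda>x. (f x)\<^sup>2)"

lemma square_integrable_measurable [measurable_dest]:
  "square_integrable M f \<Longrightarrow> f \<in> borel_measurable M"
  by (simp add: square_integrable_def)

lemma abs_mult_le_half_sum_squares:
  fixes s t :: real
  shows "\<bar>s * t\<bar> \<le> (s\<^sup>2 + t\<^sup>2) / 2"
  using sum_squares_bound[of "\<bar>s\<bar>" "\<bar>t\<bar>"] by (simp add: abs_mult)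

lemma integrable_mult_square_integrable:
  assumes f: "square_integrable M f" and g: "square_integrable M g"
  shows "integrable M (\<lambda>x. f x * g x)"
proof (rule Bochner_Integration.integrable_bound)
  show "integrable M (\<lambda>x. (f x)\<^sup>2 + (g x)\<^sup>2)"
    using f g by (simp add: square_integrable_def)
  show "(\<lambda>x. f x * g x) \<in> borel_measurable M"
    using f g by measurable
  have "\<bar>s * t\<bar> \<le> s\<^sup>2 + t\<^sup>2" for s t :: real
    by (rule order_trans[OF abs_mult_le_half_sum_squares]) simp
  then show "AE x in M. norm (f x * g x) \<le> norm ((f x)\<^sup>2 + (g x)\<^sup>2)"
    by simp
qed

lemma square_integrable_linear:
  assumes f: "square_integrable M f" and g: "square_integrable M g"
  shows "square_integrable M (\<lambda>x. s * f x + t * g x)"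
proof -
  have "integrable M (\<lambda>x. s\<^sup>2 * (f x)\<^sup>2 + t\<^sup>2 * (g x)\<^sup>2 + 2 * s * t * (f x * g x))"
    using f g integrable_mult_square_integrable[OF f g] by (auto simp: square_integrable_def)
  then have "integrable M (\<lambda>x. (s * f x + t * g x)\<^sup>2)"
    by (simp add: power2_eq_square algebra_simps)
  moreover have "(\<lambda>x. s * f x + t * g x) \<in> borel_measurable M"
    using f g by measurable
  ultimately show ?thesis
    by (simp add: square_integrable_def)
qed

lemma square_integrable_cong_AE:
  assumes "square_integrable M f" "g \<in> borel_measurable M" "AE x in M. f x = g x"
  shows "square_integrable M g"
proof -
  have "integrable M (\<lambda>x. (g x)\<^sup>2) = integrable M (\<lambda>x. (f x)\<^sup>2)"
    using assms by (intro integrable_cong_AE) (auto simp: square_integrable_def)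
  with assms show ?thesis by (simp add: square_integrable_def)
qed

lemma inner_linear:
  assumes "square_integrable M f" "square_integrable M g" "square_integrable M h"
  shows "(LINT x|M. h x * (s * f x + t * g x))
    = s * (LINT x|M. h x * f x) + t * (LINT x|M. h x * g x)"
proof -
  have "(LINT x|M. h x * (s * f x + t * g x)) = (LINT x|M. s * (h x * f x) + t * (h x * g x))"
    by (simp add: algebra_simps)
  with assms show ?thesis by (simp add: integrable_mult_square_integrable)
qed

lemma norm_square_linear:
  assumes f: "square_integrable M f" and g: "square_integrable M g"
  shows "(LINT x|M. (s * f x + t * g x)\<^sup>2)
    = s\<^sup>2 * (LINT x|M. f x * f x) + 2 * s * t * (LINT x|M. f x * g x) + t\<^sup>2 * (LINT x|M. g x * g x)"
proof -
  have "(LINT x|M. (s * f x + t * g x)\<^sup>2)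
    = (LINT x|M. s\<^sup>2 * (f x * f x) + 2 * s * t * (f x * g x) + t\<^sup>2 * (g x * g x))"
    by (simp add: algebra_simps power2_eq_square)
  with f g show ?thesis by (simp add: integrable_mult_square_integrable)
qed

text \<open>
  The quadratic form \<open>(s, t) \<mapsto> \<parallel>s f + t g\<parallel>\<^sup>2\<close> is nonnegative; if \<open>g\<close> has positive norm, evaluate it at
  \<open>s = \<parallel>g\<parallel>\<^sup>2\<close>, \<open>t = - \<langle>f, g\<rangle>\<close>, and otherwise it is affine in \<open>t\<close>, which forces \<open>\<langle>f, g\<rangle> = 0\<close>.
\<close>

lemma cauchy_schwarz_square_integrable:
  assumes f: "square_integrable M f" and g: "square_integrable M g"
  shows "(LINT x|M. f x * g x)\<^sup>2 \<le> (LINT x|M. f x * f x) * (LINT x|M. g x * g x)"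
proof -
  let ?F = "LINT x|M. f x * f x" and ?G = "LINT x|M. g x * g x" and ?X = "LINT x|M. f x * g x"
  have *: "0 \<le> s\<^sup>2 * ?F + 2 * s * t * ?X + t\<^sup>2 * ?G" for s t
    unfolding norm_square_linear[OF f g, symmetric] by (rule integral_nonneg_AE) simp
  have G: "0 \<le> ?G" by (rule integral_nonneg_AE) simp
  show ?thesis
  proof (cases "?G = 0")
    case True
    have "?X = 0"
    proof (rule ccontr)
      assume X: "?X \<noteq> 0"
      from *[of 1 "- (?F + 1) / (2 * ?X)"] X True show False by (simp add: field_simps)
    qed
    with True show ?thesis by simp
  next
    case False
    from *[of ?G "- ?X"] have "0 \<le> ?G * (?F * ?G - ?X\<^sup>2)"
      by (simp add: power2_eq_square algebra_simps)
    moreover from False G have "0 < ?G" by (rule le_neq_trans[rotated, OF not_sym])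
    ultimately have "0 \<le> ?F * ?G - ?X\<^sup>2" by (simp only: zero_le_mult_iff) auto
    then show ?thesis by linarith
  qed
qed

lemma (in finite_measure) square_integrable_bounded:
  assumes "f \<in> borel_measurable M" "\<And>x. x \<in> space M \<Longrightarrow> \<bar>f x\<bar> \<le> D"
  shows "square_integrable M f"
proof -
  have "integrable M (\<lambda>x. (f x)\<^sup>2)"
  proof (rule integrable_const_bound[where B="D\<^sup>2"])
    show "AE x in M. norm ((f x)\<^sup>2) \<le> D\<^sup>2"
      using assms(2) by (auto intro!: AE_I2 simp: abs_le_square_iff[symmetric] power2_abs)
        (meson abs_ge_self order_trans)
  qed (use assms in simp)
  with assms show ?thesis by (simp add: square_integrable_def)
qed

section \<open>Integral operators bounded by the Schur test\<close>

text \<open>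
  A symmetric kernel whose absolute row integrals are at most \<open>a\<close>. By symmetry the same bound holds
  for the columns, so the Schur test bounds the integral operator by \<open>a\<close> both on bounded functions
  and on square-integrable functions. Bounded functions carry the Neumann series below, where every
  identity holds pointwise; square-integrable functions carry the quadratic form.
\<close>

locale schur_kernel = finite_measure M for M :: "'a measure" +
  fixes b :: "'a \<Rightarrow> 'a \<Rightarrow> real" and a :: real
  assumes kernel_measurable [measurable]: "case_prod b \<in> borel_measurable (M \<Otimes>\<^sub>M M)"
    and symmetric: "x \<in> space M \<Longrightarrow> y \<in> space M \<Longrightarrow> b x y = b y x"
    and row_integrable: "x \<in> space M \<Longrightarrow> integrable M (b x)"
    and row_bound: "x \<in> space M \<Longrightarrow> (LINT y|M. \<bar>b x y\<bar>) \<le> a"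
begin

sublocale pair_sigma_finite M M ..

abbreviation ip where "ip f g \<equiv> (LINT x|M. f x * g x)"

definition int_op :: "('a \<Rightarrow> real) \<Rightarrow> 'a \<Rightarrow> real" where
  "int_op f x = (LINT y|M. b x y * f y)"

lemma op_measurable [measurable]:
  assumes [measurable]: "f \<in> borel_measurable M"
  shows "int_op f \<in> borel_measurable M"
  unfolding int_op_def by measurable

text \<open>
  Integrating first over \<open>y\<close> turns the weight into a row integral. This and its mirror image are the
  two halves of the Schur test: the product \<open>f x * b x y * g y\<close> is dominated by half the sum of
  \<open>\<bar>b x y\<bar> * (f x)\<^sup>2\<close> and \<open>\<bar>b x y\<bar> * (g y)\<^sup>2\<close>.
\<close>

lemma weighted_square:
  assumes f: "square_integrable M f"
  shows "integrable (M \<Otimes>\<^sub>M M) (\<lambda>(x,y). \<bar>b x y\<bar> * (f x)\<^sup>2)" (is "integrable _ ?F")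
    and "(LINT p|(M \<Otimes>\<^sub>M M). (\<lambda>(x,y). \<bar>b x y\<bar> * (f x)\<^sup>2) p) \<le> a * ip f f"
proof -
  have [measurable]: "f \<in> borel_measurable M" using f by measurable
  have *: "(LINT y|M. \<bar>b x y\<bar> * (f x)\<^sup>2) \<le> a * (f x)\<^sup>2" if "x \<in> space M" for x
    using row_bound[OF that] row_integrable[OF that] by (simp add: mult_right_mono)
  have int: "integrable M (\<lambda>x. LINT y|M. \<bar>b x y\<bar> * (f x)\<^sup>2)"
  proof (rule Bochner_Integration.integrable_bound)
    show "integrable M (\<lambda>x. a * (f x)\<^sup>2)" using f by (simp add: square_integrable_def)
    show "AE x in M. norm (LINT y|M. \<bar>b x y\<bar> * (f x)\<^sup>2) \<le> norm (a * (f x)\<^sup>2)"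
    proof (rule AE_I2)
      fix x assume x: "x \<in> space M"
      have "0 \<le> (LINT y|M. \<bar>b x y\<bar> * (f x)\<^sup>2)" by (rule integral_nonneg_AE) simp
      with *[OF x] show "norm (LINT y|M. \<bar>b x y\<bar> * (f x)\<^sup>2) \<le> norm (a * (f x)\<^sup>2)"
        by simp
    qed
  qed measurable
  show I: "integrable (M \<Otimes>\<^sub>M M) ?F"
  proof (rule Fubini_integrable)
    show "integrable M (\<lambda>x. LINT y|M. norm (?F (x, y)))" using int by simp
    show "AE x in M. integrable M (\<lambda>y. ?F (x, y))"
      using row_integrable by (intro AE_I2) simp
  qed measurable
  have "(LINT p|(M \<Otimes>\<^sub>M M). ?F p) = (LINT x|M. LINT y|M. \<bar>b x y\<bar> * (f x)\<^sup>2)"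
    using integral_fst'[OF I] by simp
  also have "\<dots> \<le> (LINT x|M. a * (f x)\<^sup>2)"
    using f * int by (intro integral_mono) (auto simp: square_integrable_def)
  finally show "(LINT p|(M \<Otimes>\<^sub>M M). ?F p) \<le> a * ip f f" by (simp add: power2_eq_square)
qed

lemma weighted_square':
  assumes f: "square_integrable M f"
  shows "integrable (M \<Otimes>\<^sub>M M) (\<lambda>(x,y). \<bar>b x y\<bar> * (f y)\<^sup>2)"
    and "(LINT p|(M \<Otimes>\<^sub>M M). (\<lambda>(x,y). \<bar>b x y\<bar> * (f y)\<^sup>2) p) \<le> a * ip f f"
proof -
  have [measurable]: "f \<in> borel_measurable M" using f by measurable
  let ?F = "\<lambda>(x,y). \<bar>b x y\<bar> * (f x)\<^sup>2"
  have sw: "p \<in> space (M \<Otimes>\<^sub>M M) \<Longrightarrow> (\<lambda>(x,y). ?F (y,x)) p = (\<lambda>(x,y). \<bar>b x y\<bar> * (f y)\<^sup>2) p" for p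
    using symmetric by (auto simp: space_pair_measure)
  have "integrable (M \<Otimes>\<^sub>M M) (\<lambda>(x,y). ?F (y,x))"
    using weighted_square(1)[OF f] by (rule integrable_product_swap)
  then show "integrable (M \<Otimes>\<^sub>M M) (\<lambda>(x,y). \<bar>b x y\<bar> * (f y)\<^sup>2)"
    using sw by (simp cong: Bochner_Integration.integrable_cong)
  have "(LINT p|(M \<Otimes>\<^sub>M M). (\<lambda>(x,y). \<bar>b x y\<bar> * (f y)\<^sup>2) p) = (LINT p|(M \<Otimes>\<^sub>M M). (\<lambda>(x,y). ?F (y,x)) p)"
    using sw by (intro Bochner_Integration.integral_cong) auto
  also have "\<dots> = (LINT p|(M \<Otimes>\<^sub>M M). ?F p)"
    by (rule integral_product_swap) measurable
  finally show "(LINT p|(M \<Otimes>\<^sub>M M). (\<lambda>(x,y). \<bar>b x y\<bar> * (f y)\<^sup>2) p) \<le> a * ip f f"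
    using weighted_square(2)[OF f] by simp
qed

lemma form_integrable:
  assumes f: "square_integrable M f" and g: "square_integrable M g"
  shows "integrable (M \<Otimes>\<^sub>M M) (\<lambda>(x,y). f x * (b x y * g y))"
proof (rule Bochner_Integration.integrable_bound)
  have [measurable]: "f \<in> borel_measurable M" "g \<in> borel_measurable M" using f g by measurable
  show "(\<lambda>(x,y). f x * (b x y * g y)) \<in> borel_measurable (M \<Otimes>\<^sub>M M)" by measurable
  show "integrable (M \<Otimes>\<^sub>M M) (\<lambda>p. (\<lambda>(x,y). \<bar>b x y\<bar> * (f x)\<^sup>2) p + (\<lambda>(x,y). \<bar>b x y\<bar> * (g y)\<^sup>2) p)"
    using weighted_square(1)[OF f] weighted_square'(1)[OF g] by (rule Bochner_Integration.integrable_add)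
  have "\<bar>s * (c * t)\<bar> \<le> \<bar>c\<bar> * s\<^sup>2 + \<bar>c\<bar> * t\<^sup>2" for s t c :: real
  proof -
    have "\<bar>s * t\<bar> \<le> s\<^sup>2 + t\<^sup>2"
      by (rule order_trans[OF abs_mult_le_half_sum_squares]) simp
    from mult_left_mono[OF this, of "\<bar>c\<bar>"] show ?thesis by (simp add: abs_mult algebra_simps)
  qed
  then show "AE p in M \<Otimes>\<^sub>M M. norm (case p of (x, y) \<Rightarrow> f x * (b x y * g y))
    \<le> norm ((\<lambda>(x,y). \<bar>b x y\<bar> * (f x)\<^sup>2) p + (\<lambda>(x,y). \<bar>b x y\<bar> * (g y)\<^sup>2) p)"
    by (auto simp: split_beta)
qed

text \<open>
  For a merely square-integrable \<open>g\<close> the integral defining \<open>int_op g x\<close> may diverge on a null set of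
  \<open>x\<close>, where it takes a default value. Linearity of \<open>int_op\<close> on such functions is therefore only an
  almost everywhere statement.
\<close>

lemma row_product_integrable:
  assumes g: "square_integrable M g"
  shows "AE x in M. integrable M (\<lambda>y. b x y * g y)"
proof -
  have "square_integrable M (\<lambda>x. 1)" by (rule square_integrable_bounded) auto
  from AE_integrable_fst'[OF form_integrable[OF this g]] show ?thesis by simp
qed

lemma inner_op:
  assumes f: "square_integrable M f" and g: "square_integrable M g"
  shows "ip f (int_op g) = (LINT p|(M \<Otimes>\<^sub>M M). (\<lambda>(x,y). f x * (b x y * g y)) p)"
  using integral_fst'[OF form_integrable[OF f g]] by (simp add: int_op_def)

lemma inner_op_symmetric:
  assumes f: "square_integrable M f" and g: "square_integrable M g"
  shows "ip f (int_op g) = ip g (int_op f)"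
proof -
  have [measurable]: "f \<in> borel_measurable M" "g \<in> borel_measurable M" using f g by measurable
  let ?F = "\<lambda>(x,y). f x * (b x y * g y)"
  have "ip f (int_op g) = (LINT p|(M \<Otimes>\<^sub>M M). (\<lambda>(x,y). ?F (y,x)) p)"
    unfolding inner_op[OF f g] by (rule integral_product_swap[symmetric]) measurable
  also have "\<dots> = ip g (int_op f)"
    unfolding inner_op[OF g f]
    by (intro Bochner_Integration.integral_cong) (auto simp: space_pair_measure symmetric)
  finally show ?thesis .
qed

lemma inner_op_le:
  assumes f: "square_integrable M f"
  shows "ip f (int_op f) \<le> a * ip f f"
proof -
  let ?F = "\<lambda>(x,y). \<bar>b x y\<bar> * (f x)\<^sup>2" and ?G = "\<lambda>(x,y). \<bar>b x y\<bar> * (f y)\<^sup>2"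
  have "s * (c * t) \<le> \<bar>c\<bar> * s\<^sup>2 / 2 + \<bar>c\<bar> * t\<^sup>2 / 2" for s t c :: real
  proof -
    have "\<bar>s * t\<bar> \<le> (s\<^sup>2 + t\<^sup>2) / 2"
      by (rule abs_mult_le_half_sum_squares)
    from mult_left_mono[OF this, of "\<bar>c\<bar>"] have "\<bar>s * (c * t)\<bar> \<le> \<bar>c\<bar> * s\<^sup>2 / 2 + \<bar>c\<bar> * t\<^sup>2 / 2"
      by (simp add: abs_mult algebra_simps add_divide_distrib)
    then show ?thesis by linarith
  qed
  moreover have "integrable (M \<Otimes>\<^sub>M M) (\<lambda>p. ?F p / 2 + ?G p / 2)"
    using weighted_square(1)[OF f] weighted_square'(1)[OF f] by simp
  ultimately have "ip f (int_op f) \<le> (LINT p|(M \<Otimes>\<^sub>M M). ?F p / 2 + ?G p / 2)"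
    unfolding inner_op[OF f f] by (intro integral_mono[OF form_integrable[OF f f]]) auto
  also have "\<dots> = (LINT p|(M \<Otimes>\<^sub>M M). ?F p) / 2 + (LINT p|(M \<Otimes>\<^sub>M M). ?G p) / 2"
    using weighted_square(1)[OF f] weighted_square'(1)[OF f] by simp
  also have "\<dots> \<le> a * ip f f"
    using weighted_square(2)[OF f] weighted_square'(2)[OF f] by linarith
  finally show ?thesis .
qed

text \<open>
  The pointwise bound \<open>(int_op f x)\<^sup>2 \<le> C * (\<integral> \<bar>b x y\<bar> * (f y)\<^sup>2 dy)\<close> is the Cauchy-Schwarz inequality for
  the measure \<open>\<bar>b x y\<bar> dy\<close>, whose total mass is at most \<open>C\<close>; its right-hand side is integrable in
  \<open>x\<close> by the Schur test.
\<close>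

lemma op_square_integrable:
  assumes f: "square_integrable M f"
  shows "square_integrable M (int_op f)"
proof -
  have [measurable]: "f \<in> borel_measurable M" using f by measurable
  let ?Q = "\<lambda>x. LINT y|M. \<bar>b x y\<bar> * (f y)\<^sup>2"
  note W = weighted_square'(1)[OF f]
  have "AE x in M. (int_op f x)\<^sup>2 \<le> (\<bar>a\<bar> + 1) * ?Q x"
    using row_product_integrable[OF f] AE_integrable_fst'[OF W] AE_space
  proof eventually_elim
    case (elim x)
    \<comment> \<open>\<open>a\<close> may vanish, so a strictly larger constant is used as a divisor.\<close>
    define C A where "C = \<bar>a\<bar> + 1" and "A = int_op f x"
    have C: "C > 0" by (simp add: C_def)
    have row: "integrable M (\<lambda>y. \<bar>b x y\<bar>)" using row_integrable[OF elim(3)] by simp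
    have "0 \<le> (LINT y|M. A\<^sup>2 * \<bar>b x y\<bar> + C\<^sup>2 * (\<bar>b x y\<bar> * (f y)\<^sup>2) - 2 * A * C * (b x y * f y))"
    proof (rule integral_nonneg_AE, rule AE_I2)
      fix y
      have "A\<^sup>2 * \<bar>b x y\<bar> + C\<^sup>2 * (\<bar>b x y\<bar> * (f y)\<^sup>2) - 2 * A * C * (b x y * f y)
        = \<bar>b x y\<bar> * (A - sgn (b x y) * C * f y)\<^sup>2"
        by (cases "b x y" "0::real" rule: linorder_cases) (auto simp: power2_eq_square algebra_simps)
      then show "0 \<le> A\<^sup>2 * \<bar>b x y\<bar> + C\<^sup>2 * (\<bar>b x y\<bar> * (f y)\<^sup>2) - 2 * A * C * (b x y * f y)"
        by simp
    qed
    also have "\<dots> = A\<^sup>2 * (LINT y|M. \<bar>b x y\<bar>) + C\<^sup>2 * ?Q x - 2 * A * C * A"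
      using row elim by (simp add: A_def int_op_def)
    also have "\<dots> \<le> A\<^sup>2 * C + C\<^sup>2 * ?Q x - 2 * A * C * A"
      using row_bound[OF elim(3)] by (auto intro!: mult_left_mono simp: C_def)
    also have "\<dots> = C * (C * ?Q x - A\<^sup>2)" by (simp add: power2_eq_square algebra_simps)
    finally have "A\<^sup>2 \<le> C * ?Q x" using C by (simp add: zero_le_mult_iff)
    then show ?case by (simp add: A_def C_def)
  qed
  moreover have "integrable M (\<lambda>x. (\<bar>a\<bar> + 1) * ?Q x)"
    using integrable_fst'[OF W] by simp
  ultimately have "integrable M (\<lambda>x. (int_op f x)\<^sup>2)"
    by (rule_tac Bochner_Integration.integrable_bound[of M "\<lambda>x. (\<bar>a\<bar> + 1) * ?Q x"]) (auto elim!: eventually_mono)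
  then show ?thesis by (simp add: square_integrable_def)
qed

lemma op_bound:
  assumes "f \<in> borel_measurable M" "\<And>y. y \<in> space M \<Longrightarrow> \<bar>f y\<bar> \<le> D" "x \<in> space M"
  shows "integrable M (\<lambda>y. b x y * f y)" and "\<bar>int_op f x\<bar> \<le> a * D"
proof -
  have [measurable]: "f \<in> borel_measurable M" by fact
  have D: "0 \<le> D" using assms(2,3) abs_ge_zero order_trans by blast
  have int: "integrable M (\<lambda>y. D * \<bar>b x y\<bar>)" using row_integrable[OF assms(3)] by simp
  have le: "\<bar>b x y * f y\<bar> \<le> D * \<bar>b x y\<bar>" if "y \<in> space M" for y
    using mult_right_mono[OF assms(2)[OF that], of "\<bar>b x y\<bar>"] by (simp add: abs_mult mult.commute)
  show I: "integrable M (\<lambda>y. b x y * f y)"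
    using assms(3) le D row_integrable[OF assms(3)] by (intro Bochner_Integration.integrable_bound[OF int]) (auto intro!: AE_I2)
  have "\<bar>int_op f x\<bar> \<le> (LINT y|M. \<bar>b x y * f y\<bar>)"
    unfolding int_op_def using integral_norm_bound[of M "\<lambda>y. b x y * f y"] by simp
  also have "\<dots> \<le> (LINT y|M. D * \<bar>b x y\<bar>)" using I int le by (intro integral_mono) auto
  also have "\<dots> \<le> a * D" using mult_left_mono[OF row_bound[OF assms(3)] D] by (simp add: mult.commute)
  finally show "\<bar>int_op f x\<bar> \<le> a * D" .
qed

lemma square_integrable_const: "square_integrable M (\<lambda>x. s)"
  by (rule square_integrable_bounded[where D="\<bar>s\<bar>"]) auto

lemma int_op_linear_AE:
  assumes f: "square_integrable M f" and g: "square_integrable M g"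
  shows "AE x in M. int_op (\<lambda>x. s * f x + t * g x) x = s * int_op f x + t * int_op g x"
  using row_product_integrable[OF f] row_product_integrable[OF g]
proof eventually_elim
  case (elim x)
  have "int_op (\<lambda>x. s * f x + t * g x) x = (LINT y|M. s * (b x y * f y) + t * (b x y * g y))"
    unfolding int_op_def by (simp add: algebra_simps)
  with elim show ?case by (simp add: int_op_def)
qed

lemma form_linear:
  fixes s t :: real
  assumes f: "square_integrable M f" and g: "square_integrable M g"
  defines "u \<equiv> \<lambda>x. s * f x + t * g x"
  shows "ip u (int_op u) = s\<^sup>2 * ip f (int_op f) + 2 * s * t * ip f (int_op g) + t\<^sup>2 * ip g (int_op g)"
proof -
  have u: "square_integrable M u"
    unfolding u_def using f g by (rule square_integrable_linear)
  note F = op_square_integrable[OF f] and G = op_square_integrable[OF g]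
  have *: "ip h (int_op u) = s * ip h (int_op f) + t * ip h (int_op g)" if h: "square_integrable M h" for h
  proof -
    have "ip h (int_op u) = (LINT x|M. h x * (s * int_op f x + t * int_op g x))"
    proof (rule integral_cong_AE)
      show "AE x in M. h x * int_op u x = h x * (s * int_op f x + t * int_op g x)"
        using int_op_linear_AE[OF f g, of s t] by eventually_elim (simp add: u_def)
    qed (use h u f g in measurable)
    also have "\<dots> = s * ip h (int_op f) + t * ip h (int_op g)"
      using inner_linear[OF F G h] .
    finally show ?thesis .
  qed
  have "ip u (int_op u) = s * ip u (int_op f) + t * ip u (int_op g)" using *[OF u] .
  also have "ip u (int_op f) = s * ip f (int_op f) + t * ip f (int_op g)"
    using *[OF f] inner_op_symmetric[OF u f] by simp
  also have "ip u (int_op g) = s * ip f (int_op g) + t * ip g (int_op g)"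
    using *[OF g] inner_op_symmetric[OF u g] inner_op_symmetric[OF f g] by simp
  finally show ?thesis by (simp add: power2_eq_square algebra_simps)
qed

section \<open>The Neumann series of the constant function\<close>

text \<open>
  The vectors \<open>B\<^sup>n 1\<close> for the integral operator \<open>B\<close>. They are bounded by \<open>a\<^sup>n\<close>, so the Neumann series
  built from them converges geometrically at every point.
\<close>

definition iterate :: "nat \<Rightarrow> 'a \<Rightarrow> real" where
  "iterate n = (int_op ^^ n) (\<lambda>_. 1)"

lemma iterate_Suc: "iterate (Suc n) = int_op (iterate n)"
  by (simp add: iterate_def)

lemma iterate_measurable [measurable]: "iterate n \<in> borel_measurable M"
  by (induction n) (simp_all add: iterate_Suc op_measurable, simp add: iterate_def)

lemma iterate_bound: "x \<in> space M \<Longrightarrow> \<bar>iterate n x\<bar> \<le> a ^ n"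
proof (induction n arbitrary: x)
  case 0
  show ?case by (simp add: iterate_def)
next
  case (Suc n)
  from op_bound(2)[OF iterate_measurable Suc.IH Suc.prems] show ?case by (simp add: iterate_Suc)
qed

lemma bound_nonneg: "x \<in> space M \<Longrightarrow> 0 \<le> a"
  by (rule order_trans[OF integral_nonneg_AE row_bound]) auto

text \<open>
  With \<open>r = 1 / \<lambda>\<close> this is the resolvent \<open>(\<lambda> - B)\<^sup>-\<^sup>1 1\<close>, written in the variable in which it is a
  power series.
\<close>

definition neumann :: "real \<Rightarrow> 'a \<Rightarrow> real" where
  "neumann r x = (\<Sum>n. r ^ Suc n * iterate n x)"

context
  fixes r :: real
  assumes r: "0 \<le> r" "a * r < 1" and ne: "space M \<noteq> {}"
begin

lemma a_nonneg: "0 \<le> a"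
  using ne bound_nonneg by auto

lemma geometric_sums: "(\<lambda>n. r ^ Suc n * a ^ n) sums (r / (1 - a * r))"
proof -
  have "(\<lambda>n. r * (a * r) ^ n) sums (r * (1 / (1 - a * r)))"
    using r a_nonneg by (intro sums_mult geometric_sums) (simp add: abs_mult)
  then show ?thesis by (simp add: power_mult_distrib mult_ac)
qed

lemma neumann_term_bound: "x \<in> space M \<Longrightarrow> norm (r ^ Suc n * iterate n x) \<le> r ^ Suc n * a ^ n"
  using iterate_bound[of x n] r by (simp add: abs_mult mult_left_mono)

lemma neumann_summable: "x \<in> space M \<Longrightarrow> summable (\<lambda>n. norm (r ^ Suc n * iterate n x))"
  by (rule summable_comparison_test'[OF sums_summable[OF geometric_sums]]) (use neumann_term_bound in auto)

lemma neumann_measurable: "neumann r \<in> borel_measurable M"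
  unfolding neumann_def by measurable

lemma neumann_bound: "x \<in> space M \<Longrightarrow> \<bar>neumann r x\<bar> \<le> r / (1 - a * r)"
  unfolding neumann_def
  using norm_suminf_le[OF neumann_term_bound sums_summable[OF geometric_sums]] sums_unique[OF geometric_sums]
  by simp

lemma neumann_equation:
  assumes x: "x \<in> space M"
  shows "neumann r x = r * (1 + int_op (neumann r) x)"
proof -
  let ?f = "\<lambda>n y. b x y * (r ^ Suc n * iterate n y)"
  have int: "integrable M (?f n)" for n
    by (rule op_bound(1)[OF _ _ x]) (use neumann_term_bound in auto)
  have sm: "summable (\<lambda>n. norm (?f n y))" if "y \<in> space M" for y
    using summable_mult[OF neumann_summable[OF that], of "\<bar>b x y\<bar>"] by (simp add: abs_mult)
  have nb: "(LINT y|M. norm (?f n y)) \<le> a * (r ^ Suc n * a ^ n)" for n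
  proof -
    have le: "norm (?f n y) \<le> (r ^ Suc n * a ^ n) * \<bar>b x y\<bar>" if "y \<in> space M" for y
      using mult_right_mono[OF neumann_term_bound[OF that, of n], of "\<bar>b x y\<bar>"]
      by (simp only: real_norm_def abs_mult mult_ac)
    have "(LINT y|M. norm (?f n y)) \<le> (LINT y|M. (r ^ Suc n * a ^ n) * \<bar>b x y\<bar>)"
      using row_integrable[OF x] by (intro integral_mono integrable_norm[OF int] le) auto
    also have "\<dots> \<le> a * (r ^ Suc n * a ^ n)"
      using mult_left_mono[OF row_bound[OF x], of "r ^ Suc n * a ^ n"] r a_nonneg
      by (simp add: mult_ac)
    finally show ?thesis .
  qed
  have "summable (\<lambda>n. LINT y|M. norm (?f n y))"
    by (rule summable_comparison_test'[OF summable_mult[OF sums_summable[OF geometric_sums], of a]])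
      (use nb in simp)
  then have "(\<lambda>n. LINT y|M. ?f n y) sums (LINT y|M. (\<Sum>n. ?f n y))"
    using int sm by (intro sums_integral) auto
  also have "(LINT y|M. (\<Sum>n. ?f n y)) = int_op (neumann r) x"
    unfolding int_op_def neumann_def
    by (intro Bochner_Integration.integral_cong refl suminf_mult summable_norm_cancel[OF neumann_summable])
  also have "(\<lambda>n. LINT y|M. ?f n y) = (\<lambda>n. LINT y|M. r ^ Suc n * (b x y * iterate n y))"
    by (simp only: mult.left_commute)
  also have "\<dots> = (\<lambda>n. r ^ Suc n * iterate (Suc n) x)"
    by (simp only: iterate_Suc int_op_def integral_mult_right_zero)
  finally have "(\<lambda>n. r * (r ^ Suc n * iterate (Suc n) x)) sums (r * int_op (neumann r) x)"
    by (rule sums_mult)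
  then have "(\<lambda>n. r ^ Suc (Suc n) * iterate (Suc n) x) sums (r * int_op (neumann r) x)"
    by (simp add: mult.assoc)
  then have "(\<lambda>n. r ^ Suc n * iterate n x) sums (r * int_op (neumann r) x + r)"
    by (subst (asm) sums_Suc_iff) (simp add: iterate_def)
  then show ?thesis by (simp add: neumann_def sums_iff algebra_simps)
qed

text \<open>
  The mean of the resolvent is a power series in \<open>r\<close>, hence continuous in \<open>r\<close>; this is what the
  intermediate value theorem is applied to.
\<close>

lemma integral_neumann:
  "(\<lambda>n. (LINT x|M. iterate n x) * r ^ n) sums ((LINT x|M. neumann r x) / r)" if "r \<noteq> 0"
proof -
  let ?f = "\<lambda>n x. r ^ Suc n * iterate n x"
  have int: "integrable M (?f n)" for n
    by (rule integrable_const_bound[where B="r ^ Suc n * a ^ n"]) (use neumann_term_bound in auto)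
  have nb: "(LINT y|M. norm (?f n y)) \<le> measure M (space M) * (r ^ Suc n * a ^ n)" for n
  proof -
    have "(LINT y|M. norm (?f n y)) \<le> (LINT y|M. r ^ Suc n * a ^ n)"
      using int neumann_term_bound by (intro integral_mono) auto
    then show ?thesis by simp
  qed
  have "summable (\<lambda>n. LINT y|M. norm (?f n y))"
    by (rule summable_comparison_test'[OF summable_mult[OF sums_summable[OF geometric_sums], of "measure M (space M)"]])
      (use nb in simp)
  then have "(\<lambda>n. LINT y|M. ?f n y) sums (LINT y|M. neumann r y)"
    unfolding neumann_def using int neumann_summable by (intro sums_integral) auto
  from sums_divide[OF this, of r] that show ?thesis by (simp add: mult_ac)
qed

end

section \<open>Rank-one perturbation and its leading eigenvalue\<close>

text \<open>
  The operator with kernel \<open>b + c\<close>, that is \<open>B + c 1\<otimes>1\<close>.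
\<close>

definition perturbed :: "real \<Rightarrow> ('a \<Rightarrow> real) \<Rightarrow> 'a \<Rightarrow> real" where
  "perturbed c f x = int_op f x + c * (LINT y|M. f y)"

lemma perturbed_square_integrable:
  assumes f: "square_integrable M f"
  shows "square_integrable M (perturbed c f)"
  using square_integrable_linear[OF op_square_integrable[OF f] square_integrable_const, of 1 1]
  by (simp add: perturbed_def[abs_def])

lemma inner_perturbed:
  assumes f: "square_integrable M f" and g: "square_integrable M g"
  shows "ip f (perturbed c g) = ip f (int_op g) + c * (LINT x|M. f x) * (LINT x|M. g x)"
  using inner_linear[OF op_square_integrable[OF g] square_integrable_const f, of 1 1]
  by (simp add: perturbed_def)

text \<open>
  For \<open>\<lambda> > a\<close>, the resolvent \<open>\<phi> = (\<lambda> - B)\<^sup>-\<^sup>1 1\<close> is an eigenfunction of \<open>B + c 1\<otimes>1\<close> with eigenvalue \<open>\<lambda>\<close> as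
  soon as \<open>c \<langle>1, \<phi>\<rangle> = 1\<close>. At \<open>\<lambda> = c + a\<close> the geometric bound gives \<open>c \<langle>1, \<phi>\<rangle> \<le> 1\<close>. At \<open>\<lambda> = c\<close> the form
  of \<open>c - B\<close> is nonnegative, and \<open>\<langle>1, (c - B) 1\<rangle> \<le> c\<close> because the row integrals are nonnegative;
  testing the form on \<open>\<phi> - 1 / c\<close> gives \<open>c \<langle>1, \<phi>\<rangle> \<ge> 1\<close>. The intermediate value
  theorem finds the eigenvalue in between.
\<close>

lemma perturbed_eigenfunction:
  assumes mass: "measure M (space M) = 1" and c: "a < c"
    and rows: "\<And>x. x \<in> space M \<Longrightarrow> 0 \<le> (LINT y|M. b x y)"
  obtains lam phi where "c \<le> lam" "square_integrable M phi" "c * (LINT x|M. phi x) = 1"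
    "\<And>x. x \<in> space M \<Longrightarrow> lam * phi x = int_op phi x + 1"
proof -
  have ne: "space M \<noteq> {}" using mass by auto
  then have a0: "0 \<le> a" using bound_nonneg by auto
  with c have c0: "0 < c" by simp
  define m where "m r = (LINT x|M. neumann r x)" for r
  define p where "p r = r * (\<Sum>n. (LINT x|M. iterate n x) * r ^ n)" for r
  have small: "a * r < 1" if "0 \<le> r" "r \<le> 1 / c" for r
  proof -
    have "a * r \<le> a * (1 / c)" using a0 that by (intro mult_left_mono) auto
    also have "\<dots> < 1" using c c0 by simp
    finally show ?thesis .
  qed
  have mp: "m r = p r" if "0 < r" "r \<le> 1 / c" for r
    using integral_neumann[OF _ small ne, of r] that by (auto simp: m_def p_def sums_iff)
  have psi: "square_integrable M (neumann r)" if "0 \<le> r" "r \<le> 1 / c" for r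
    using neumann_measurable[OF that(1) small[OF that] ne] neumann_bound[OF that(1) small[OF that] ne]
    by (rule square_integrable_bounded)

  have cont: "isCont p r" if "0 < r" "r \<le> 1 / c" for r
  proof -
    \<comment> \<open>The reciprocal of the mean of \<open>a\<close> and \<open>c\<close>: beyond the largest argument \<open>1 / c\<close>, yet within reach of the bound \<open>a ^ n\<close> on the coefficients.\<close>
    let ?K = "2 / (a + c)"
    have "a * ?K < 1" using a0 c0 c by (simp add: field_simps)
    then have "summable (\<lambda>n. (LINT x|M. iterate n x) * ?K ^ n)"
      using integral_neumann[OF _ _ ne, of ?K] a0 c0 by (auto simp: sums_iff)
    moreover have "norm r < norm ?K"
    proof -
      have "1 / c < ?K" using a0 c0 c by (simp add: field_simps)
      with that a0 c0 show ?thesis by simp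
    qed
    ultimately show ?thesis unfolding p_def by (intro continuous_intros isCont_powser)
  qed

  have low: "p (1 / (c + a)) \<le> 1 / c"
  proof -
    let ?r = "1 / (c + a)"
    have r: "0 \<le> ?r" "?r \<le> 1 / c" "0 < ?r" using a0 c0 by (auto simp: field_simps)
    have "neumann ?r x \<le> 1 / c" if "x \<in> space M" for x
    proof -
      have "neumann ?r x \<le> ?r / (1 - a * ?r)"
        using neumann_bound[OF r(1) small[OF r(1,2)] ne that] by linarith
      also have "\<dots> = 1 / c" using a0 c0 by (simp add: field_simps)
      finally show ?thesis .
    qed
    then have "m ?r \<le> (LINT x|M. 1 / c)"
      unfolding m_def
      using integrable_mult_square_integrable[OF psi[OF r(1,2)] square_integrable_const[of 1]]
      by (intro integral_mono) auto
    then show ?thesis using mass mp[OF r(3,2)] by simp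
  qed

  have high: "1 / c \<le> p (1 / c)"
  proof -
    have r: "0 \<le> 1 / c" "1 / c \<le> 1 / c" "0 < 1 / c" using c0 by auto
    let ?psi = "neumann (1 / c)" and ?one = "\<lambda>_::'a. 1::real"
    note P = psi[OF r(1,2)] and O = square_integrable_const[of 1]
    have eq: "int_op ?psi x = c * ?psi x - 1" if "x \<in> space M" for x
      using neumann_equation[OF r(1) small[OF r(1,2)] ne that] c0 by (simp add: field_simps)
    have EP: "ip ?psi (int_op ?psi) = c * ip ?psi ?psi - m (1 / c)"
    proof -
      have "ip ?psi (int_op ?psi) = (LINT x|M. ?psi x * (c * ?psi x + (-1) * 1))"
        by (intro Bochner_Integration.integral_cong) (auto simp: eq)
      also have "\<dots> = c * ip ?psi ?psi - m (1 / c)"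
        using inner_linear[OF P O P, of c "-1"] by (simp add: m_def)
      finally show ?thesis .
    qed
    have EO: "ip ?one (int_op ?psi) = c * m (1 / c) - 1"
    proof -
      have "ip ?one (int_op ?psi) = (LINT x|M. 1 * (c * ?psi x + (-1) * 1))"
        by (intro Bochner_Integration.integral_cong) (auto simp: eq)
      also have "\<dots> = c * m (1 / c) - 1"
        using inner_linear[OF P O O, of c "-1"] mass by (simp add: m_def)
      finally show ?thesis .
    qed
    have OO: "0 \<le> ip ?one (int_op ?one)"
      using rows by (intro integral_nonneg_AE AE_I2) (simp add: int_op_def)
    \<comment> \<open>\<open>1 / c\<close> is the resolvent \<open>(c - B)\<^sup>-\<^sup>1 1\<close> when \<open>B 1 = 0\<close>, the extreme case of the hypothesis on rows.\<close>
    define u where "u = (\<lambda>x. 1 * ?psi x + (- 1 / c) * 1)"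
    have U: "square_integrable M u"
      unfolding u_def using P O by (rule square_integrable_linear)
    have "ip u (int_op u) \<le> a * ip u u" using inner_op_le[OF U] .
    also have "\<dots> \<le> c * ip u u"
      using c by (intro mult_right_mono integral_nonneg_AE) auto
    also have "ip u u = ip ?psi ?psi - 2 / c * m (1 / c) + 1 / c\<^sup>2"
      using norm_square_linear[OF P O, of 1 "-1/c"] mass
      by (simp add: u_def m_def power2_eq_square)
    finally have "ip u (int_op u) \<le> c * (ip ?psi ?psi - 2 / c * m (1 / c) + 1 / c\<^sup>2)" .
    moreover have "ip u (int_op u) = c * ip ?psi ?psi - m (1 / c) - 2 / c * (c * m (1 / c) - 1)
        + ip ?one (int_op ?one) / c\<^sup>2"
      using form_linear[OF P O, of 1 "-1/c"] EP EO inner_op_symmetric[OF P O]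
      by (simp add: u_def power2_eq_square)
    moreover have "2 / c * (c * m (1 / c) - 1) = 2 * m (1 / c) - 2 / c"
      using c0 by (simp add: field_simps)
    moreover have "c * (ip ?psi ?psi - 2 / c * m (1 / c) + 1 / c\<^sup>2)
        = c * ip ?psi ?psi - 2 * m (1 / c) + 1 / c"
      using c0 by (simp add: power2_eq_square field_simps)
    moreover have "2 / c = 1 / c + 1 / c" by simp
    ultimately have "ip ?one (int_op ?one) / c\<^sup>2 + 1 / c \<le> m (1 / c)"
      by linarith
    then have "1 / c \<le> m (1 / c)"
      using divide_nonneg_nonneg[OF OO zero_le_power2[of c]] by linarith
    then show ?thesis using mp[OF r(3,2)] by simp
  qed

  have "\<exists>r. 1 / (c + a) \<le> r \<and> r \<le> 1 / c \<and> p r = 1 / c"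
  proof (rule IVT)
    show "\<forall>r. 1 / (c + a) \<le> r \<and> r \<le> 1 / c \<longrightarrow> isCont p r"
    proof (intro allI impI)
      fix r assume "1 / (c + a) \<le> r \<and> r \<le> 1 / c"
      moreover have "0 < 1 / (c + a)" using a0 c0 by simp
      ultimately have "0 < r" "r \<le> 1 / c" by linarith+
      then show "isCont p r" by (rule cont)
    qed
  qed (use low high a0 c0 in \<open>auto simp: field_simps\<close>)
  then obtain r where r: "1 / (c + a) \<le> r" "r \<le> 1 / c" "p r = 1 / c" by blast
  have "0 < 1 / (c + a)" using a0 c0 by simp
  with r have r0: "0 < r" "0 \<le> r" by linarith+
  show thesis
  proof
    show "c \<le> 1 / r" using r(2) r0 c0 by (simp add: field_simps)
    show "square_integrable M (neumann r)" using psi r(2) r0 by auto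
    show "c * (LINT x|M. neumann r x) = 1" using mp[of r] r r0 c0 by (simp add: m_def)
    show "1 / r * neumann r x = int_op (neumann r) x + 1" if "x \<in> space M" for x
      using neumann_equation[OF r0(2) small[OF r0(2) r(2)] ne that] r0 by (simp add: field_simps)
  qed
qed

text \<open>
  Write \<open>K = B + c 1\<otimes>1\<close> and let \<open>\<phi>\<close> be the eigenfunction above. Every \<open>g\<close> satisfies
  \<open>\<langle>g, K g\<rangle> \<le> a \<parallel>g\<parallel>\<^sup>2 + (\<lambda> - a) \<langle>g, \<phi>\<rangle>\<^sup>2 / \<parallel>\<phi>\<parallel>\<^sup>2\<close>,
  which says that \<open>K \<le> a\<close> on the orthogonal complement of \<open>\<phi>\<close>. Indeed, subtracting from \<open>g\<close> the multiple
  of \<open>\<phi>\<close> that makes its mean vanish leaves a function on which the forms of \<open>K\<close> and \<open>B\<close> coincide.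
  Since the last term is at most \<open>(\<lambda> - a) \<parallel>g\<parallel>\<^sup>2\<close>, the Rayleigh quotient is at most \<open>\<lambda>\<close>. The last conclusion
  is \<open>\<langle>g, (\<lambda> - K) (a - K) g\<rangle> \<ge> 0\<close>. Here
  \<open>(\<lambda> - K) (a - K) = (a - K)\<^sup>2 + (\<lambda> - a) (a - K)\<close>; the inequality above bounds the second term from below, and
  Cauchy-Schwarz against \<open>\<phi>\<close> shows that \<open>\<parallel>(a - K) g\<parallel>\<^sup>2\<close> makes up for the deficit.
\<close>

lemma leading_eigenvalue:
  assumes mass: "measure M (space M) = 1" and c: "a < c"
    and rows: "\<And>x. x \<in> space M \<Longrightarrow> 0 \<le> (LINT y|M. b x y)"
  obtains lam phi where "a < lam" "square_integrable M phi" "\<not> (AE x in M. phi x = 0)"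
    "\<And>x. x \<in> space M \<Longrightarrow> perturbed c phi x = lam * phi x"
    "\<And>g. square_integrable M g \<Longrightarrow> ip g (perturbed c g) \<le> lam * ip g g"
    "\<And>g. square_integrable M g \<Longrightarrow> (lam + a) * ip g (perturbed c g)
       \<le> ip (perturbed c g) (perturbed c g) + lam * a * ip g g"
proof -
  have "space M \<noteq> {}" using mass by auto
  then have a0: "0 \<le> a" using bound_nonneg by auto
  with c have c0: "0 < c" by simp
  obtain lam phi where lam: "c \<le> lam" and phi: "square_integrable M phi"
    and norm: "c * (LINT x|M. phi x) = 1"
    and eq: "\<And>x. x \<in> space M \<Longrightarrow> lam * phi x = int_op phi x + 1"
    using perturbed_eigenfunction[OF assms] by metis
  have al: "a < lam" using c lam by simp
  have nz: "\<not> (AE x in M. phi x = 0)"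
  proof
    assume "AE x in M. phi x = 0"
    then have "(LINT x|M. phi x) = 0" by (rule integral_eq_zero_AE)
    with norm show False by simp
  qed
  define F where "F = ip phi phi"
  have F: "F > 0"
  proof -
    have "0 \<le> F" unfolding F_def by (rule integral_nonneg_AE) simp
    moreover have "F \<noteq> 0"
      using nz integral_nonneg_eq_0_iff_AE[OF integrable_mult_square_integrable[OF phi phi]]
      by (auto simp: F_def)
    ultimately show ?thesis by simp
  qed
  have E: "ip g (int_op phi) = lam * ip g phi - (LINT x|M. g x)" if g: "square_integrable M g" for g
  proof -
    have "ip g (int_op phi) = (LINT x|M. g x * (lam * phi x + (-1) * 1))"
      by (intro Bochner_Integration.integral_cong) (auto simp: eq)
    then show ?thesis
      using inner_linear[OF phi square_integrable_const[of 1] g, of lam "-1"] by simp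
  qed
  have ray: "ip g (perturbed c g) \<le> a * ip g g + (lam - a) * ((ip g phi)\<^sup>2 / F)"
    if g: "square_integrable M g" for g
  proof -
    define i s X where "i = (LINT x|M. g x)" and "s = c * i" and "X = ip g phi"
    define u where "u = (\<lambda>x. 1 * g x + (- s) * phi x)"
    have U: "square_integrable M u" unfolding u_def using g phi by (rule square_integrable_linear)
    have "ip u (int_op u) = ip g (int_op g) - 2 * s * (lam * X - i) + s\<^sup>2 * (lam * F - (LINT x|M. phi x))"
      using form_linear[OF g phi, of 1 "-s"] E[OF g] E[OF phi] by (simp add: u_def i_def F_def X_def)
    also have "s\<^sup>2 * (lam * F - (LINT x|M. phi x)) = s\<^sup>2 * lam * F - s * i * (c * (LINT x|M. phi x))"
      by (simp add: s_def power2_eq_square algebra_simps)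
    also have "\<dots> = s\<^sup>2 * lam * F - s * i" using norm by simp
    also have "ip g (int_op g) = ip g (perturbed c g) - s * i"
      using inner_perturbed[OF g g, of c] by (simp add: i_def s_def)
    finally have 1: "ip u (int_op u) = ip g (perturbed c g) - 2 * s * lam * X + s\<^sup>2 * lam * F"
      by (simp add: algebra_simps)
    have 2: "ip u u = ip g g - 2 * s * X + s\<^sup>2 * F"
      using norm_square_linear[OF g phi, of 1 "-s"] by (simp add: u_def F_def X_def power2_eq_square)
    \<comment> \<open>The quadratic in \<open>s\<close> is largest at \<open>X / F\<close>, so the particular value of \<open>s\<close> drops out.\<close>
    have "2 * s * X - s\<^sup>2 * F \<le> X\<^sup>2 / F"
    proof -
      have "0 \<le> (X - s * F)\<^sup>2 / F" using F by simp
      also have "\<dots> = X\<^sup>2 / F - (2 * s * X - s\<^sup>2 * F)"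
        using F by (simp add: power2_eq_square field_simps)
      finally show ?thesis by simp
    qed
    then have "(lam - a) * (2 * s * X - s\<^sup>2 * F) \<le> (lam - a) * (X\<^sup>2 / F)"
      using al by (intro mult_left_mono) auto
    with inner_op_le[OF U] show ?thesis unfolding 1 2 X_def[symmetric] by (simp add: algebra_simps)
  qed
  show thesis
  proof
    show "a < lam" "square_integrable M phi" "\<not> (AE x in M. phi x = 0)" by fact+
    show "perturbed c phi x = lam * phi x" if "x \<in> space M" for x
      using eq[OF that] norm by (simp add: perturbed_def)
    fix g assume g: "square_integrable M g"
    note K = perturbed_square_integrable[OF g, of c]
    define N X P where "N = ip g g" and "X = (ip g phi)\<^sup>2 / F" and "P = ip g (perturbed c g)"
    have R: "P \<le> a * N + (lam - a) * X" using ray[OF g] by (simp add: N_def X_def P_def)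
    have "X \<le> N"
      using cauchy_schwarz_square_integrable[OF g phi] F by (simp add: X_def N_def F_def divide_le_eq)
    then have "(lam - a) * X \<le> (lam - a) * N" using al by (intro mult_left_mono) auto
    with R show "ip g (perturbed c g) \<le> lam * ip g g" by (simp add: P_def N_def algebra_simps)
    define v where "v = (\<lambda>x. a * g x + (- 1) * perturbed c g x)"
    have V: "square_integrable M v" unfolding v_def using g K by (rule square_integrable_linear)
    have "ip phi (perturbed c g) = lam * ip g phi"
      using inner_perturbed[OF phi g, of c] inner_op_symmetric[OF phi g] E[OF g] norm by simp
    moreover have "ip v phi = ip phi v" and "ip phi g = ip g phi"
      by (simp_all only: mult.commute)
    ultimately have "ip v phi = (a - lam) * ip g phi"
      using inner_linear[OF g K phi, of a "-1"] by (simp add: v_def left_diff_distrib)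
    then have "(a - lam)\<^sup>2 * (ip g phi)\<^sup>2 \<le> ip v v * F"
      using cauchy_schwarz_square_integrable[OF V phi] by (simp add: F_def power_mult_distrib)
    then have "(a - lam)\<^sup>2 * X \<le> ip v v" using F by (simp add: X_def divide_le_eq)
    also have "ip v v = a\<^sup>2 * N - 2 * a * P + ip (perturbed c g) (perturbed c g)"
      using norm_square_linear[OF g K, of a "-1"] by (simp add: v_def N_def P_def power2_eq_square)
    finally have "(lam - a) * ((lam - a) * X) \<le> a\<^sup>2 * N - 2 * a * P + ip (perturbed c g) (perturbed c g)"
      by (simp add: power2_eq_square algebra_simps)
    moreover have "(lam - a) * P \<le> (lam - a) * (a * N + (lam - a) * X)"
      using R al by (intro mult_left_mono) auto
    ultimately show "(lam + a) * ip g (perturbed c g)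
       \<le> ip (perturbed c g) (perturbed c g) + lam * a * ip g g"
      unfolding P_def[symmetric] N_def[symmetric] by (simp add: power2_eq_square algebra_simps)
  qed
qed

end

section \<open>Row integrals of the kernel on the unit interval\<close>

text \<open>
  This is \<open>\<integral> \<bar>s powr (-1/2) - 2\<bar> ds\<close> over \<open>(0, r)\<close>: the integrand changes sign at \<open>s = 1/4\<close>.
\<close>

definition shifted_mass :: "real \<Rightarrow> real" where
  "shifted_mass r = (if r \<le> 1/4 then 2 * sqrt r - 2 * r else 2 * r - 2 * sqrt r + 1)"

text \<open>
  Splitting the row at \<open>y = x\<close> reduces the integral of a function of \<open>\<bar>x - y\<bar>\<close> to a primitive on each
  side. The primitive is only continuous at \<open>0\<close>, where the weight may be singular, and finitely many
  further kinks are allowed.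
\<close>

lemma integral_leb01_abs_diff:
  fixes w W :: "real \<Rightarrow> real"
  assumes x: "x \<in> {0<..<1}"
    and fin: "finite S"
    and deriv: "\<And>r. r \<in> {0<..<1} - S \<Longrightarrow> (W has_real_derivative w r) (at r)"
    and cont: "continuous_on {0..1} W" and W0: "W 0 = 0"
    and nonneg: "\<And>r. 0 \<le> w r"
  shows "integrable leb01 (\<lambda>y. w \<bar>x - y\<bar>)"
    and "(LINT y|leb01. w \<bar>x - y\<bar>) = W x + W (1 - x)"
proof -
  have "((\<lambda>y. w \<bar>x - y\<bar>) has_integral (- W \<bar>x - x\<bar> - - W \<bar>x - 0\<bar>)) {0..x}"
  proof (rule fundamental_theorem_of_calculus_interior_strong)
    show "finite ((\<lambda>s. x - s) ` S)" using fin by simp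
    show "((\<lambda>y. - W \<bar>x - y\<bar>) has_vector_derivative w \<bar>x - y\<bar>) (at y)"
      if "y \<in> {0<..<x} - (\<lambda>s. x - s) ` S" for y
    proof -
      have y: "0 < y" "y < x" using that by auto
      have "x - y \<notin> S" using that by (auto simp: image_iff)
      then have d: "(W has_real_derivative w (x - y)) (at (x - y))" using deriv[of "x - y"] x y by auto
      have "((\<lambda>y. W (x - y)) has_real_derivative w (x - y) * (-1)) (at y)"
        by (rule DERIV_chain2[where g="\<lambda>y. x - y", OF d]) (auto intro!: derivative_eq_intros)
      from DERIV_minus[OF this] have "((\<lambda>y. - W (x - y)) has_real_derivative w (x - y)) (at y)"
        by simp
      then have "((\<lambda>y. - W \<bar>x - y\<bar>) has_real_derivative w (x - y)) (at y)"
        by (rule DERIV_cong_ev[OF refl _ refl, THEN iffD1, rotated])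
          (use y eventually_nhds_in_open[of "{..<x}" y] in \<open>auto elim!: eventually_mono\<close>)
      then show ?thesis using y by (simp add: has_real_derivative_iff_has_vector_derivative)
    qed
    show "continuous_on {0..x} (\<lambda>y. - W \<bar>x - y\<bar>)"
      using x by (intro continuous_intros continuous_on_compose2[OF cont]) auto
  qed (use x in auto)
  then have 1: "((\<lambda>y. w \<bar>x - y\<bar>) has_integral W x) {0..x}" using x W0 by simp
  have "((\<lambda>y. w \<bar>x - y\<bar>) has_integral (W \<bar>x - 1\<bar> - W \<bar>x - x\<bar>)) {x..1}"
  proof (rule fundamental_theorem_of_calculus_interior_strong)
    show "finite ((\<lambda>s. x + s) ` S)" using fin by simp
    show "((\<lambda>y. W \<bar>x - y\<bar>) has_vector_derivative w \<bar>x - y\<bar>) (at y)"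
      if "y \<in> {x<..<1} - (\<lambda>s. x + s) ` S" for y
    proof -
      have y: "x < y" "y < 1" using that by auto
      have "y - x \<notin> S" using that by (auto simp: image_iff)
      then have d: "(W has_real_derivative w (y - x)) (at (y - x))" using deriv[of "y - x"] x y by auto
      have "((\<lambda>y. W (y - x)) has_real_derivative w (y - x) * 1) (at y)"
        by (rule DERIV_chain2[where g="\<lambda>y. y - x", OF d]) (auto intro!: derivative_eq_intros)
      then have "((\<lambda>y. W \<bar>x - y\<bar>) has_real_derivative w (y - x) * 1) (at y)"
        by (rule DERIV_cong_ev[OF refl _ refl, THEN iffD1, rotated])
          (use y eventually_nhds_in_open[of "{x<..}" y] in \<open>auto elim!: eventually_mono\<close>)
      then show ?thesis using y by (simp add: has_real_derivative_iff_has_vector_derivative)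
    qed
    show "continuous_on {x..1} (\<lambda>y. W \<bar>x - y\<bar>)"
      using x by (intro continuous_intros continuous_on_compose2[OF cont]) auto
  qed (use x in auto)
  then have 2: "((\<lambda>y. w \<bar>x - y\<bar>) has_integral W (1 - x)) {x..1}" using x W0 by simp
  have H: "((\<lambda>y. w \<bar>x - y\<bar>) has_integral (W x + W (1 - x))) {0<..<1}"
    using has_integral_combine[OF _ _ 1 2] x by (simp add: has_integral_Icc_iff_Ioo)
  have "(\<lambda>y. w \<bar>x - y\<bar>) absolutely_integrable_on {0<..<1}"
    using H nonneg by (intro nonnegative_absolutely_integrable_1) (auto simp: integrable_on_def)
  then show I: "integrable leb01 (\<lambda>y. w \<bar>x - y\<bar>)"
    by (simp add: integrable_restrict_space set_integrable_def)
  show "(LINT y|leb01. w \<bar>x - y\<bar>) = W x + W (1 - x)"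
    using lebesgue_integral_eq_integral[OF I] H by (simp add: integral_unique)
qed

lemma kernel_row:
  assumes x: "x \<in> {0<..<1}"
  shows "integrable leb01 (\<lambda>y. \<bar>x - y\<bar> powr (-1/2))"
    and "(LINT y|leb01. \<bar>x - y\<bar> powr (-1/2)) = 2 * sqrt x + 2 * sqrt (1 - x)"
proof -
  have d: "((\<lambda>r. 2 * sqrt r) has_real_derivative r powr (-1/2)) (at r)" if "r \<in> {0<..<1} - {}" for r
    using that by (auto intro!: derivative_eq_intros simp: powr_minus powr_half_sqrt field_simps)
  have c: "continuous_on {0..1} (\<lambda>r::real. 2 * sqrt r)"
    by (intro continuous_intros)
  show "integrable leb01 (\<lambda>y. \<bar>x - y\<bar> powr (-1/2))"
    and "(LINT y|leb01. \<bar>x - y\<bar> powr (-1/2)) = 2 * sqrt x + 2 * sqrt (1 - x)"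
    using integral_leb01_abs_diff[OF x _ d c] by auto
qed

lemma shifted_kernel_row:
  assumes x: "x \<in> {0<..<1}"
  shows "integrable leb01 (\<lambda>y. \<bar>\<bar>x - y\<bar> powr (-1/2) - 2\<bar>)"
    and "(LINT y|leb01. \<bar>\<bar>x - y\<bar> powr (-1/2) - 2\<bar>) = shifted_mass x + shifted_mass (1 - x)"
proof -
  have s14: "sqrt (1/4) = (1/2::real)" by (simp add: real_sqrt_divide)
  have d: "(shifted_mass has_real_derivative \<bar>r powr (-1/2) - 2\<bar>) (at r)" if r: "r \<in> {0<..<1} - {1/4}" for r
  proof (cases "r < 1/4")
    case True
    have "sqrt r < 1/2" using True real_sqrt_less_mono[of r "1/4"] s14 by simp
    then have abs: "\<bar>r powr (-1/2) - 2\<bar> = r powr (-1/2) - 2"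
      using r by (simp add: powr_minus powr_half_sqrt field_simps)
    have "((\<lambda>r. 2 * sqrt r - 2 * r) has_real_derivative r powr (-1/2) - 2) (at r)"
      using r by (auto intro!: derivative_eq_intros simp: powr_minus powr_half_sqrt field_simps)
    then show ?thesis unfolding abs
      by (rule DERIV_cong_ev[OF refl _ refl, THEN iffD1, rotated])
          (use True eventually_nhds_in_open[of "{..<1/4}" r] in \<open>auto elim!: eventually_mono simp: shifted_mass_def\<close>)
  next
    case False
    with r have r4: "r > 1/4" by auto
    have "sqrt r > 1/2" using r4 real_sqrt_less_mono[of "1/4" r] s14 by simp
    then have abs: "\<bar>r powr (-1/2) - 2\<bar> = 2 - r powr (-1/2)"
      using r by (simp add: powr_minus powr_half_sqrt field_simps)
    have "((\<lambda>r. 2 * r - 2 * sqrt r + 1) has_real_derivative 2 - r powr (-1/2)) (at r)"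
      using r by (auto intro!: derivative_eq_intros simp: powr_minus powr_half_sqrt field_simps)
    then show ?thesis unfolding abs
      by (rule DERIV_cong_ev[OF refl _ refl, THEN iffD1, rotated])
          (use r4 eventually_nhds_in_open[of "{1/4<..}" r] in \<open>auto elim!: eventually_mono simp: shifted_mass_def\<close>)
  qed
  have c: "continuous_on {0..1} shifted_mass"
  proof -
    have "2 * sqrt r - 2 * r = 2 * r - 2 * sqrt r + 1" if "\<not> r < 1/4" "\<not> 1/4 < r" for r :: real
    proof -
      have "r = 1/4" using that by simp
      then show ?thesis by (simp only: s14)
    qed
    then have "continuous_on ({0..1/4} \<union> {1/4..1}) shifted_mass"
      unfolding shifted_mass_def by (intro continuous_on_If continuous_intros) auto
    moreover have "{0..1/4} \<union> {1/4..1} = {0..1::real}" by auto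
    ultimately show ?thesis by simp
  qed
  have mass0: "shifted_mass 0 = 0" by (simp add: shifted_mass_def)
  show "integrable leb01 (\<lambda>y. \<bar>\<bar>x - y\<bar> powr (-1/2) - 2\<bar>)"
    and "(LINT y|leb01. \<bar>\<bar>x - y\<bar> powr (-1/2) - 2\<bar>) = shifted_mass x + shifted_mass (1 - x)"
    using integral_leb01_abs_diff[where S="{1/4}", OF x _ d c _ abs_ge_zero] by (simp_all add: mass0)
qed

lemma sqrt_sum_ge:
  assumes "1/4 \<le> x" "x \<le> 3/4"
  shows "sqrt x + sqrt (1 - x) \<ge> (1 + sqrt 3) / 2"
proof (rule power2_le_imp_le)
  have "(x - 1/4) * (3/4 - x) \<ge> 0" using assms by simp
  also have "(x - 1/4) * (3/4 - x) = x * (1 - x) - 3/16" by (simp add: field_simps)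
  finally have "3/16 \<le> x * (1 - x)" by simp
  then have "sqrt (3/16) \<le> sqrt (x * (1 - x))" by (rule real_sqrt_le_mono)
  moreover have "sqrt (3/16) = sqrt 3 / 4" by (simp add: real_sqrt_divide)
  moreover have "(sqrt x + sqrt (1 - x))\<^sup>2 = 1 + 2 * sqrt (x * (1 - x))"
    using assms by (simp add: power2_sum real_sqrt_mult)
  moreover have "((1 + sqrt 3) / 2)\<^sup>2 = 1 + sqrt (3::real) / 2"
    by (simp add: power2_sum power_divide)
  ultimately show "((1 + sqrt 3) / 2)\<^sup>2 \<le> (sqrt x + sqrt (1 - x))\<^sup>2"
    by linarith
  show "0 \<le> sqrt x + sqrt (1 - x)" using assms by simp
qed

text \<open>
  For \<open>x \<le> 1/4\<close> the row integral is \<open>2 sqrt x + 3 - 4 x - 2 sqrt (1 - x)\<close>. Replacing the concave function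
  \<open>sqrt (1 - x)\<close> by its chord over \<open>[0, 1/4]\<close> leaves \<open>1 + 2 s - 4 (sqrt 3 - 1) s\<^sup>2\<close> in \<open>s = sqrt x\<close>, and
  the maximum of this parabola is exactly \<open>(9 + sqrt 3) / 8\<close>.
\<close>

lemma shifted_row_bound_left:
  assumes "0 \<le> x" "x \<le> 1/4"
  shows "shifted_mass x + shifted_mass (1 - x) \<le> a_S"
proof -
  define q where "q = sqrt (3::real)"
  define s where "s = sqrt x"
  have q: "q\<^sup>2 = 3" "q > 1" by (simp_all add: q_def)
  have s: "s\<^sup>2 = x" using assms by (simp add: s_def)
  have "q < 2" unfolding q_def by (rule real_less_lsqrt) auto
  have chord: "1 - 2 * (2 - q) * x \<le> sqrt (1 - x)"
  proof (rule real_le_rsqrt)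
    have *: "1 - x - (1 - 2 * (2 - q) * x)\<^sup>2 = x * (4 * (2 - q) - 1 - 4 * (2 - q)\<^sup>2 * x)"
      by (simp add: power2_eq_square algebra_simps)
    have "4 * (2 - q)\<^sup>2 * x \<le> (2 - q)\<^sup>2"
      using assms mult_left_mono[of "4 * x" 1 "(2 - q)\<^sup>2"] by (simp add: algebra_simps)
    also have "(2 - q)\<^sup>2 = 4 * (2 - q) - 1" using q by (simp add: power2_eq_square algebra_simps)
    finally have "0 \<le> x * (4 * (2 - q) - 1 - 4 * (2 - q)\<^sup>2 * x)" using assms by simp
    with * show "(1 - 2 * (2 - q) * x)\<^sup>2 \<le> 1 - x" by linarith
  qed
  have "shifted_mass x + shifted_mass (1 - x) = 2 * s - 4 * x + 3 - 2 * sqrt (1 - x)"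
    using assms by (auto simp: shifted_mass_def s_def)
  also have "\<dots> \<le> 1 + 2 * s - 4 * (q - 1) * x" using chord by (simp add: algebra_simps)
  also have "\<dots> \<le> 1 + (q + 1) / 8"
  proof -
    \<comment> \<open>Completing the square at the vertex \<open>s = 1 / (4 (q - 1))\<close>; \<open>(q - 1) (q + 1) = 2\<close>.\<close>
    have "0 \<le> (4 * (q - 1) * s - 1)\<^sup>2" by simp
    also have "\<dots> = 4 * (q - 1) * (4 * (q - 1) * x - 2 * s) + 1"
      unfolding s[symmetric] by (simp add: power2_eq_square algebra_simps)
    also have "\<dots> = 4 * (q - 1) * (4 * (q - 1) * x - 2 * s + (q + 1) / 8)"
      using q by (simp add: power2_eq_square field_simps)
    finally have "0 \<le> 4 * (q - 1) * (4 * (q - 1) * x - 2 * s + (q + 1) / 8)" .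
    then have "0 \<le> 4 * (q - 1) * x - 2 * s + (q + 1) / 8" using q by (simp only: zero_le_mult_iff) auto
    then show ?thesis by linarith
  qed
  finally show ?thesis by (simp add: a_S_def q_def add_divide_distrib)
qed

lemma shifted_row_bound:
  assumes x: "x \<in> {0<..<1}"
  shows "shifted_mass x + shifted_mass (1 - x) \<le> a_S"
proof -
  consider "x \<le> 1/4" | "1/4 < x" "x < 3/4" | "3/4 \<le> x" by linarith
  then show ?thesis
  proof cases
    case 1 then show ?thesis using x shifted_row_bound_left by auto
  next
    case 2
    have "sqrt 3 \<ge> (1.7::real)" by (rule real_le_rsqrt) (simp add: power2_eq_square)
    with 2 sqrt_sum_ge[of x] show ?thesis by (simp add: shifted_mass_def a_S_def)
  next
    case 3 then show ?thesis using x shifted_row_bound_left[of "1 - x"] by (auto simp: add.commute)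
  qed
qed

section \<open>The operator with kernel \<open>\<bar>x - y\<bar> powr (-1/2)\<close>\<close>

lemma L2_01_iff: "f \<in> L2_01 \<longleftrightarrow> square_integrable leb01 f"
  by (simp add: L2_01_def square_integrable_def)

lemma L2_nrm_square: "(L2_nrm f)\<^sup>2 = L2_inner f f"
  unfolding L2_nrm_def by (rule real_sqrt_pow2) (simp add: L2_inner_def integral_nonneg_AE)

lemma measure_leb01: "measure leb01 (space leb01) = 1"
  by (simp add: measure_restrict_space space_restrict_space)

lemma finite_measure_leb01: "finite_measure leb01"
  by (rule finite_measureI) (simp add: emeasure_restrict_space space_restrict_space)

text \<open>
  The subtracted constant is larger than the Schur bound \<open>a_S\<close> of the remainder, and small enough for the
  row integrals of the remainder to stay nonnegative, as the existence of the leading eigenfunction requires.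
\<close>

definition shifted_kernel :: "real \<Rightarrow> real \<Rightarrow> real" where
  "shifted_kernel x y = \<bar>x - y\<bar> powr (-1/2) - 2"

interpretation shifted: schur_kernel leb01 shifted_kernel a_S
proof (intro schur_kernel.intro schur_kernel_axioms.intro finite_measure_leb01)
  have [measurable]: "(\<lambda>x. x) \<in> borel_measurable leb01"
    using id_borel_measurable_lebesgue_on by (simp add: id_def)
  show "case_prod shifted_kernel \<in> borel_measurable (leb01 \<Otimes>\<^sub>M leb01)"
  proof -
    have [measurable]: "(\<lambda>p. fst p) \<in> borel_measurable (leb01 \<Otimes>\<^sub>M leb01)"
      by (rule measurable_compose[OF measurable_fst]) measurable
    have [measurable]: "(\<lambda>p. snd p) \<in> borel_measurable (leb01 \<Otimes>\<^sub>M leb01)"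
      by (rule measurable_compose[OF measurable_snd]) measurable
    show ?thesis unfolding split_beta shifted_kernel_def by measurable
  qed
  fix x assume "x \<in> space leb01"
  then have x: "x \<in> {0<..<1}" by (simp add: space_restrict_space)
  show "shifted_kernel x y = shifted_kernel y x" for y by (simp add: shifted_kernel_def abs_minus_commute)
  show "integrable leb01 (shifted_kernel x)"
    using kernel_row(1)[OF x] finite_measure.integrable_const[OF finite_measure_leb01]
    unfolding shifted_kernel_def[abs_def] by (intro Bochner_Integration.integrable_diff)
  show "(LINT y|leb01. \<bar>shifted_kernel x y\<bar>) \<le> a_S"
    using shifted_kernel_row(2)[OF x] shifted_row_bound[OF x] by (simp add: shifted_kernel_def)
qed

text \<open>
  The full row integral is \<open>2 sqrt x + 2 sqrt (1 - x)\<close>, and \<open>sqrt t \<ge> t\<close> on the unit interval.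
\<close>

lemma shifted_row_nonneg:
  assumes "x \<in> space leb01"
  shows "0 \<le> (LINT y|leb01. shifted_kernel x y)"
proof -
  have x: "x \<in> {0<..<1}" using assms by (simp add: space_restrict_space)
  have "sqrt t \<ge> t" if "0 \<le> t" "t \<le> 1" for t :: real
    using that by (intro real_le_rsqrt) (simp add: power2_eq_square mult_left_le)
  from this[of x] this[of "1 - x"] x have "0 \<le> 2 * sqrt x + 2 * sqrt (1 - x) - 2" by auto
  also have "\<dots> = (LINT y|leb01. shifted_kernel x y)"
    using kernel_row[OF x] measure_leb01 by (simp add: shifted_kernel_def)
  finally show ?thesis .
qed

lemma K_star_eq:
  assumes f: "square_integrable leb01 f"
  shows "AE x in leb01. K_star f x = shifted.perturbed 2 f x"
  using shifted.row_product_integrable[OF f]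
proof eventually_elim
  case (elim x)
  have "integrable leb01 f"
    using integrable_mult_square_integrable[OF f shifted.square_integrable_const[of 1]] by simp
  moreover have "K_star f x = (LINT y|leb01. shifted_kernel x y * f y + 2 * f y)"
    by (simp add: K_star_def shifted_kernel_def algebra_simps)
  ultimately show ?case
    using elim by (simp add: shifted.perturbed_def shifted.int_op_def)
qed

lemma K_star_square_integrable:
  assumes f: "square_integrable leb01 f"
  shows "square_integrable leb01 (K_star f)"
proof (rule square_integrable_cong_AE[OF shifted.perturbed_square_integrable[OF f, of 2]])
  have "AE x in leb01. K_star f x = shifted.perturbed 2 f x" using f by (rule K_star_eq)
  then show "AE x in leb01. shifted.perturbed 2 f x = K_star f x" by eventually_elim simp
  have [measurable]: "f \<in> borel_measurable leb01" using f by measurable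
  have [measurable]: "(\<lambda>(x, y). \<bar>x - y\<bar> powr (-1/2)) \<in> borel_measurable (leb01 \<Otimes>\<^sub>M leb01)"
  proof -
    have "(\<lambda>p. case_prod shifted_kernel p + 2) \<in> borel_measurable (leb01 \<Otimes>\<^sub>M leb01)" by measurable
    then show ?thesis by (simp add: shifted_kernel_def split_beta')
  qed
  show "K_star f \<in> borel_measurable leb01" unfolding K_star_def by measurable
qed

lemma inner_K_star:
  assumes f: "square_integrable leb01 f" and g: "square_integrable leb01 g"
  shows "L2_inner f (K_star g) = shifted.ip f (shifted.perturbed 2 g)"
  unfolding L2_inner_def
proof (rule integral_cong_AE)
  show "AE x in leb01. f x * K_star g x = f x * shifted.perturbed 2 g x"
    using K_star_eq[OF g] by eventually_elim simp
qed (use f K_star_square_integrable[OF g] shifted.perturbed_square_integrable[OF g, of 2] in measurable)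

lemma L2_nrm_pos:
  assumes "g \<in> L2_01" and "\<not> L2_eq g (\<lambda>x. 0)"
  shows "0 < (L2_nrm g)\<^sup>2"
proof -
  have "square_integrable leb01 g" using assms by (simp add: L2_01_iff)
  from integrable_mult_square_integrable[OF this this] assms(2) have "L2_inner g g \<noteq> 0"
    unfolding L2_inner_def L2_eq_def by (simp add: integral_nonneg_eq_0_iff_AE)
  then have "(L2_nrm g)\<^sup>2 \<noteq> 0" by (simp only: L2_nrm_square not_False_eq_True)
  then show ?thesis by (simp only: zero_less_power2) simp
qed

lemma residual_shift:
  assumes "g \<in> L2_01"
  shows "(L2_nrm (\<lambda>x. K_star g x - \<tau> * g x))\<^sup>2
    = (L2_nrm (K_star g))\<^sup>2 - 2 * \<tau> * L2_inner g (K_star g) + \<tau>\<^sup>2 * (L2_nrm g)\<^sup>2"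
proof -
  have g: "square_integrable leb01 g" using assms by (simp add: L2_01_iff)
  have "(L2_nrm (\<lambda>x. K_star g x - \<tau> * g x))\<^sup>2 = (LINT x|leb01. (1 * K_star g x + (- \<tau>) * g x)\<^sup>2)"
    by (simp add: L2_nrm_square L2_inner_def flip: power2_eq_square)
  also have "\<dots> = (L2_nrm (K_star g))\<^sup>2 - 2 * \<tau> * L2_inner g (K_star g) + \<tau>\<^sup>2 * (L2_nrm g)\<^sup>2"
    using norm_square_linear[OF K_star_square_integrable[OF g] g, of 1 "- \<tau>"]
    by (simp add: L2_nrm_square L2_inner_def mult.commute[of "K_star g _" "g _"])
  finally show ?thesis .
qed

text \<open>
  An eigenvalue is the Rayleigh quotient of its eigenfunctions, so an eigenvalue that bounds all
  Rayleigh quotients is the greatest one.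
\<close>

lemma lambda_star_eqI:
  assumes eig: "L2_eigenvalue K_star lam"
    and ray: "\<And>g. g \<in> L2_01 \<Longrightarrow> L2_inner g (K_star g) \<le> lam * (L2_nrm g)\<^sup>2"
  shows "lambda_star = lam"
  unfolding lambda_star_def lambda_max_def
proof (rule Greatest_equality)
  show "L2_eigenvalue K_star lam" by fact
  fix l assume "L2_eigenvalue K_star l"
  then obtain f where f: "f \<in> L2_01" "\<not> L2_eq f (\<lambda>x. 0)" "L2_eq (K_star f) (\<lambda>x. l * f x)"
    unfolding L2_eigenvalue_def by blast
  then have sf: "square_integrable leb01 f" by (simp add: L2_01_iff)
  have "L2_inner f (K_star f) = (LINT x|leb01. l * (f x * f x))"
    unfolding L2_inner_def
  proof (rule integral_cong_AE)
    show "AE x in leb01. f x * K_star f x = l * (f x * f x)"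
      using f(3) unfolding L2_eq_def by eventually_elim simp
  qed (use sf K_star_square_integrable[OF sf] in measurable)
  also have "\<dots> = l * (L2_nrm f)\<^sup>2" by (simp add: L2_nrm_square L2_inner_def)
  finally have "l * (L2_nrm f)\<^sup>2 \<le> lam * (L2_nrm f)\<^sup>2" using ray[OF f(1)] by simp
  with L2_nrm_pos[OF f(1,2)] show "l \<le> lam" by (simp only: mult_le_cancel_right)
qed

text \<open>
  The first inequality is the Rayleigh bound. The second is \<open>\<langle>g, (\<lambda> - K) (a - K) g\<rangle> \<ge> 0\<close> for the
  greatest eigenvalue \<open>\<lambda>\<close> of \<open>K\<close> and \<open>a = a_S\<close>.
\<close>

lemma lambda_star_bounds:
  assumes "g \<in> L2_01"
  shows "L2_inner g (K_star g) \<le> lambda_star * (L2_nrm g)\<^sup>2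
    \<and> (lambda_star + a_S) * L2_inner g (K_star g)
       \<le> (L2_nrm (K_star g))\<^sup>2 + lambda_star * a_S * (L2_nrm g)\<^sup>2"
proof -
  have "sqrt 3 < (2::real)" by (rule real_less_lsqrt) auto
  then have "a_S < 2" by (simp add: a_S_def)
  show ?thesis
  proof (rule shifted.leading_eigenvalue[OF measure_leb01 \<open>a_S < 2\<close> shifted_row_nonneg])
    fix lam phi
    assume phi: "square_integrable leb01 phi" "\<not> (AE x in leb01. phi x = 0)"
        "\<And>x. x \<in> space leb01 \<Longrightarrow> shifted.perturbed 2 phi x = lam * phi x"
      and ray: "\<And>g. square_integrable leb01 g \<Longrightarrow> shifted.ip g (shifted.perturbed 2 g) \<le> lam * shifted.ip g g"
      and temple: "\<And>g. square_integrable leb01 g \<Longrightarrow> (lam + a_S) * shifted.ip g (shifted.perturbed 2 g)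
         \<le> shifted.ip (shifted.perturbed 2 g) (shifted.perturbed 2 g) + lam * a_S * shifted.ip g g"
    have "AE x in leb01. K_star phi x = lam * phi x"
      using K_star_eq[OF phi(1)] AE_space by eventually_elim (simp add: phi(3))
    then have eig: "L2_eigenvalue K_star lam"
      unfolding L2_eigenvalue_def L2_eq_def L2_01_iff
      using phi(1,2) by (intro bexI[of _ phi]) (simp_all add: L2_01_iff)
    have rayK: "L2_inner f (K_star f) \<le> lam * (L2_nrm f)\<^sup>2" if "f \<in> L2_01" for f
    proof -
      have f: "square_integrable leb01 f" using that by (simp add: L2_01_iff)
      show ?thesis
        using ray[OF f] unfolding inner_K_star[OF f f] L2_nrm_square by (simp add: L2_inner_def)
    qed
    have lam: "lambda_star = lam" using eig rayK by (rule lambda_star_eqI)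
    have g: "square_integrable leb01 g" using assms by (simp add: L2_01_iff)
    have "shifted.ip (shifted.perturbed 2 g) (shifted.perturbed 2 g) = L2_inner (K_star g) (K_star g)"
      unfolding L2_inner_def
    proof (rule integral_cong_AE)
      show "AE x in leb01. shifted.perturbed 2 g x * shifted.perturbed 2 g x = K_star g x * K_star g x"
        using K_star_eq[OF g] by eventually_elim simp
    qed (use K_star_square_integrable[OF g] shifted.perturbed_square_integrable[OF g, of 2] in measurable)
    with temple[OF g] have "(lam + a_S) * L2_inner g (K_star g)
       \<le> (L2_nrm (K_star g))\<^sup>2 + lam * a_S * (L2_nrm g)\<^sup>2"
      unfolding inner_K_star[OF g g] L2_nrm_square by (simp add: L2_inner_def)
    with rayK[OF assms] show ?thesis unfolding lam by blast
  qed
qed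

theorem proposition5p3:
  fixes g :: "real \<Rightarrow> real"
  assumes "g \<in> L2_01" and "\<not> L2_eq g (\<lambda>x. 0)"
  shows "(theta g > a_S \<longrightarrow>
            theta g \<le> lambda_star \<and>
            lambda_star \<le> theta g + sigma2 g / (theta g - a_S)) \<and>
         (\<forall>\<tau>::real. sigma2 g \<le> (L2_nrm (\<lambda>x. K_star g x - \<tau> * g x))\<^sup>2 / (L2_nrm g)\<^sup>2)"
proof -
  define N P where "N = (L2_nrm g)\<^sup>2" and "P = (L2_nrm (K_star g))\<^sup>2 / N"
  have N: "0 < N" unfolding N_def using assms by (rule L2_nrm_pos)
  have E: "L2_inner g (K_star g) = theta g * N" using N by (simp add: theta_def N_def)
  \<comment> \<open>The residual is a parabola in the shift with its minimum at \<open>theta g\<close>.\<close>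
  have res: "(L2_nrm (\<lambda>x. K_star g x - \<tau> * g x))\<^sup>2 / N = P - 2 * \<tau> * theta g + \<tau>\<^sup>2" for \<tau>
    using N unfolding residual_shift[OF assms(1)] E N_def[symmetric] P_def
    by (simp add: field_simps)
  have sigma: "sigma2 g = P - (theta g)\<^sup>2"
    using res[of "theta g"] by (simp add: sigma2_def N_def power2_eq_square)
  have shift: "sigma2 g \<le> (L2_nrm (\<lambda>x. K_star g x - \<tau> * g x))\<^sup>2 / (L2_nrm g)\<^sup>2" for \<tau>
    using res[of \<tau>] zero_le_power2[of "theta g - \<tau>"]
    unfolding N_def[symmetric] sigma by (simp add: power2_eq_square algebra_simps)
  note ray = lambda_star_bounds[OF assms(1), THEN conjunct1]
    and temple = lambda_star_bounds[OF assms(1), THEN conjunct2]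
  have "theta g * N \<le> lambda_star * N" using ray by (simp add: E N_def)
  then have le: "theta g \<le> lambda_star" using N by simp
  have "(lambda_star + a_S) * (theta g * N) \<le> (P + lambda_star * a_S) * N"
    using temple N unfolding E N_def[symmetric] P_def by (simp add: algebra_simps)
  then have "((lambda_star + a_S) * theta g) * N \<le> (P + lambda_star * a_S) * N" by (simp add: mult.assoc)
  then have "(lambda_star + a_S) * theta g \<le> P + lambda_star * a_S" using N by simp
  then have "(lambda_star - theta g) * (theta g - a_S) \<le> sigma2 g"
    unfolding sigma by (simp add: power2_eq_square algebra_simps)
  have "lambda_star \<le> theta g + sigma2 g / (theta g - a_S)" if "a_S < theta g"
  proof -
    have "lambda_star - theta g \<le> sigma2 g / (theta g - a_S)"
      using that \<open>(lambda_star - theta g) * (theta g - a_S) \<le> sigma2 g\<close> by (simp add: pos_le_divide_eq)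
    then show ?thesis by linarith
  qed
  with le shift show ?thesis by blast
qed

end
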